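(* Let $\mathcal{X}\subset\mathbb{R}^d$ be closed and convex, and let $f,g$ be continuous on $\mathcal{X}$ with $\partial f(x)\neq\emptyset$, $\partial g(x)\neq\emptyset$ for all $x\in\mathcal{X}$. Suppose there is $M>0$ with $\|\zeta_f\|\le M$ and $\|\zeta_g\|\le M$ for all $x\in\mathcal{X}$, $\zeta_f\in\partial f(x)$, $\zeta_g\in\partial g(x)$. Suppose further that: $f$ is $\rho$-weakly convex on $\mathcal{X}$ and $g$ is convex on $\mathcal{X}$; there is $x_{\mathrm{feas}}\in\mathrm{relint}(\mathcal{X})$ with $g(x_{\mathrm{feas}})<0$; and there is $D>0$ with $\|x-x'\|\le D$ for all $x,x'\in\mathcal{X}$. Let $\hat\rho>\rho$, let $\Lambda:=(MD+\hat\rho D^2)/(-g(x_{\mathrm{feas}}))$, let $\epsilon>0$, and for $x\in\mathcal{X}$ let $$\widehat{x}(x):=\arg\min_{y\in\mathcal{X}}\Big\{f(y)+\tfrac{\hat\rho}{2}\|y-x\|^2\ :\ g(y)\le 0\Big\}.$$ Let $x^{(\tau)}$ be generated by Output I of the switching subgradient method (described in the context), and write $\widehat{x}^{(t)}=\widehat{x}(x^{(t)})$. Then $$\mathbb{E}_\tau\big[\|\widehat{x}^{(\tau)}-x^{(\tau)}\|\big]\le\epsilon\quad\text{and}\quad \mathbb{E}_\tau\big[g(x^{(\tau)})\big]\le\frac{\epsilon^2(\hat\rho-\rho)}{1+\Lambda}$$ in either of the following cases. Case I: $S=0$, $\epsilon_t=\frac{\epsilon^2(\hat\rho-\rho)}{1+\Lambda}$,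 $\eta_t=\frac{2\epsilon^2(\hat\rho-\rho)}{5(1+\Lambda)M^2}$ for all $t$, and $T\ge\frac{25M^2D^2(1+\Lambda)^2}{4\epsilon^4(\hat\rho-\rho)^2}$ (a bound of order $O(1/\epsilon^4)$). Case II: $S=T/2$, $\epsilon_t=\frac{5MD}{\sqrt{t+1}}$, $\eta_t=\frac{D}{M\sqrt{t+1}}$ for all $t$, and $T\ge\frac{50M^2D^2(1+\Lambda)^2}{\epsilon^4(\hat\rho-\rho)^2}$ (a bound of order $O(1/\epsilon^4)$).
   Context: $\|\cdot\|$ is the Euclidean norm. For $h:\mathbb{R}^d\to\mathbb{R}\cup\{+\infty\}$, $\partial h(x)=\{\zeta\in\mathbb{R}^d: h(x')\ge h(x)+\langle\zeta,x'-x\rangle+o(\|x'-x\|),\ x'\to x\}$. $h$ is $\rho$-weakly convex on $\mathcal{X}$ ($\rho\ge0$) if $h(x)\ge h(x')+\langle\zeta,x-x'\rangle-\frac{\rho}{2}\|x-x'\|^2$ for all $x,x'\in\mathcal{X}$ and $\zeta\in\partial h(x')$; convex on $\mathcal{X}$ is the case $\rho=0$. The problem under study is $\min_{x\in\mathcal{X}}f(x)$ subject to $g(x)\le0$. $\mathrm{proj}_{\mathcal X}$ is Euclidean projection onto $\mathcal{X}$; relint is relative interior. Switching subgradient method. Input: $x^{(0)}\in\mathcal{X}$, number of iterations $T$ (a positive integer), tolerances $\epsilon_t\ge0$, stepsizes $\eta_t$, and an integer starting index $S$. Initialize $I=J=\emptyset$. For $t=0,1,\dots,T-1$: if $g(x^{(t)})\le\epsilon_t$,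 set $x^{(t+1)}=\mathrm{proj}_{\mathcal X}(x^{(t)}-\eta_t\zeta_f^{(t)})$ for any $\zeta_f^{(t)}\in\partial f(x^{(t)})$ and, if $t\ge S$, add $t$ to $I$; otherwise set $x^{(t+1)}=\mathrm{proj}_{\mathcal X}(x^{(t)}-\eta_t\zeta_g^{(t)})$ for any $\zeta_g^{(t)}\in\partial g(x^{(t)})$ and, if $t\ge S$, add $t$ to $J$. Output I: $x^{(\tau)}$ with $\tau$ randomly sampled from $I$ with $\mathrm{Prob}(\tau=t)=\eta_t/\sum_{s\in I}\eta_s$. $\mathbb{E}_\tau$ is the expectation over the random index $\tau$ only. A guarantee about $x^{(\tau)}$ is understood to include that the index set sampled from is nonempty. *)

theory Defs
  imports
    "HOL-Analysis.Analysis"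
    "HOL-Library.Landau_Symbols"
    "HOL-Probability.Probability_Mass_Function"
begin

text \<open>Functions into \<open>\<real> \<union> {+\<infinity>}\<close> are \<^typ>\<open>ereal\<close>-valued; the value \<open>-\<infinity>\<close> is excluded
  by hypothesis where they are used. At a point where \<open>h\<close> is finite, the set below is the Frechet
  subdifferential. At a point where \<open>h = \<infinity>\<close> it is either empty or the whole space, so a nonempty
  bounded subdifferential at \<open>x\<close> forces \<open>h x\<close> to be finite.\<close>

definition subdiff :: "(real^'d \<Rightarrow> ereal) \<Rightarrow> real^'d \<Rightarrow> (real^'d) set" where
  "subdiff h x = {\<zeta>. \<exists>r :: real^'d \<Rightarrow> real. r \<in> o[at x](\<lambda>x'. norm (x' - x)) \<and>
     (\<forall>\<^sub>F x' in at x. h x' \<ge> h x + ereal (\<zeta> \<bullet> (x' - x) + r x'))}"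

definition weakly_convex_on :: "real \<Rightarrow> (real^'d) set \<Rightarrow> (real^'d \<Rightarrow> ereal) \<Rightarrow> bool" where
  "weakly_convex_on \<rho> X h \<longleftrightarrow> 0 \<le> \<rho> \<and>
     (\<forall>x\<in>X. \<forall>x'\<in>X. \<forall>\<zeta>\<in>subdiff h x'.
        h x \<ge> h x' + ereal (\<zeta> \<bullet> (x - x') - \<rho> / 2 * (norm (x - x'))\<^sup>2))"

text \<open>Convexity in the subgradient sense, as opposed to the library's \<^const>\<open>convex_on\<close>.\<close>

definition subgrad_convex_on :: "(real^'d) set \<Rightarrow> (real^'d \<Rightarrow> ereal) \<Rightarrow> bool" where
  "subgrad_convex_on X h \<longleftrightarrow> weakly_convex_on 0 X h"

text \<open>\<^const>\<open>arg_min\<close> is a Hilbert choice. For weakly convex \<open>f\<close>, convex \<open>g\<close> and \<open>\<rho>h > \<rho>\<close> the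
  objective is strongly convex on a convex feasible set, so the minimiser is unique if it exists.\<close>

definition prox_point ::
  "real \<Rightarrow> (real^'d) set \<Rightarrow> (real^'d \<Rightarrow> ereal) \<Rightarrow> (real^'d \<Rightarrow> ereal) \<Rightarrow> real^'d \<Rightarrow> real^'d" where
  "prox_point \<rho>h X f g x =
     arg_min (\<lambda>y. f y + ereal (\<rho>h / 2 * (norm (y - x))\<^sup>2)) (\<lambda>y. y \<in> X \<and> g y \<le> 0)"

text \<open>\<open>x\<close> is a possible sequence of iterates of \<open>T\<close> steps of the switching subgradient method with
  tolerances \<open>tol\<close> and stepsizes \<open>\<eta>\<close>: the choice of subgradient in each step is arbitrary.
  Entries of \<open>x\<close> beyond index \<open>T\<close> are unconstrained.\<close>

definition switching_subgradient_run ::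
  "(real^'d) set \<Rightarrow> (real^'d \<Rightarrow> ereal) \<Rightarrow> (real^'d \<Rightarrow> ereal) \<Rightarrow> nat \<Rightarrow> (nat \<Rightarrow> real) \<Rightarrow> (nat \<Rightarrow> real)
     \<Rightarrow> (nat \<Rightarrow> real^'d) \<Rightarrow> bool" where
  "switching_subgradient_run X f g T tol \<eta> x \<longleftrightarrow> x 0 \<in> X \<and>
     (\<forall>t<T. if g (x t) \<le> ereal (tol t)
            then \<exists>\<zeta>\<in>subdiff f (x t). x (Suc t) = closest_point X (x t - \<eta> t *\<^sub>R \<zeta>)
            else \<exists>\<zeta>\<in>subdiff g (x t). x (Suc t) = closest_point X (x t - \<eta> t *\<^sub>R \<zeta>))"

text \<open>The index set \<open>I\<close> at termination; \<open>S\<close> is the starting index. A starting index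
  \<open>T/2\<close> is read as \<open>T div 2\<close>, that is, rounded down for odd \<open>T\<close>.\<close>

definition index_set_I ::
  "(real^'d \<Rightarrow> ereal) \<Rightarrow> nat \<Rightarrow> nat \<Rightarrow> (nat \<Rightarrow> real) \<Rightarrow> (nat \<Rightarrow> real^'d) \<Rightarrow> nat set" where
  "index_set_I g S T tol x = {t. t < T \<and> S \<le> t \<and> g (x t) \<le> ereal (tol t)}"

text \<open>The law of the output index \<open>\<tau>\<close>. It is only meaningful if \<open>I\<close> is finite and nonempty and the
  weights are nonnegative with positive sum.\<close>

definition output_index :: "nat set \<Rightarrow> (nat \<Rightarrow> real) \<Rightarrow> nat pmf" where
  "output_index I \<eta> = embed_pmf (\<lambda>t. if t \<in> I then \<eta> t / (\<Sum>s\<in>I. \<eta> s) else 0)"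

end

theory Submission
  imports Defs
begin

text \<open>Each iterate \<open>x t\<close> is compared with its own proximal point
  \<open>p t\<close>, through the sum of \<open>\<eta> t * (\<zeta> t \<bullet> (x t - p t))\<close>
  over the steps from \<open>S\<close> on. From above, this sum is bounded by
  \<open>D\<^sup>2 / 2\<close> plus \<open>M\<^sup>2 / 2\<close> times the sum of the squared
  stepsizes, because the Moreau envelope of the constrained problem telescopes
  (\<open>sum_inner_prox_le\<close>). From below, a constraint step has inner product at least
  \<open>tol t\<close>, since \<open>p t\<close> is feasible and \<open>x t\<close> violates the
  constraint by more than \<open>tol t\<close>. An objective step has inner product at least
  \<open>(\<rho>h - \<rho>) * (norm (p t - x t))\<^sup>2 - multiplier * tol t\<close>; here
  \<open>prox_growth\<close> limits how far the objective can drop when the constraint is violated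
  by at most \<open>tol t\<close>, with \<Lambda> as the price per unit of violation.

  Both schedules make the weighted sum of tolerances strictly exceed the upper bound
  (\<open>constant_step_budget\<close>, \<open>decreasing_step_budget\<close>). Hence objective
  steps must occur, and their weighted mean square distance to the proximal points is below
  \<open>\<epsilon>\<^sup>2\<close> (\<open>sum_prox_distance_less\<close>), which bounds the mean
  distance by \<epsilon>. The bound on \<open>g\<close> holds at every sampled index, by the
  switching test.\<close>

section \<open>Weak convexity on segments and projected steps\<close>

lemma norm_convex_combination_diff_square:
  fixes y z a :: "'a::real_inner"
  shows "(norm ((1 - s) *\<^sub>R y + s *\<^sub>R z - a))\<^sup>2
    = (1 - s) * (norm (y - a))\<^sup>2 + s * (norm (z - a))\<^sup>2 - s * (1 - s) * (norm (y - z))\<^sup>2"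
  unfolding power2_norm_eq_inner
  by (simp add: inner_simps inner_commute algebra_simps)

text \<open>The subgradient inequality at the intermediate point is applied towards both ends. In
  the convex combination of the two the linear terms cancel, and the quadratic terms add up to the
  stated error.\<close>

lemma weakly_convex_secant:
  fixes F :: "'a::real_inner \<Rightarrow> real"
  assumes X: "convex X"
    and sub: "\<And>w. w \<in> X \<Longrightarrow> \<exists>\<zeta>. \<forall>y\<in>X. F w + \<zeta> \<bullet> (y - w) - \<rho> / 2 * (norm (y - w))\<^sup>2 \<le> F y"
    and yz: "y \<in> X" "z \<in> X" and s: "0 \<le> s" "s \<le> 1"
  shows "F ((1 - s) *\<^sub>R y + s *\<^sub>R z)
    \<le> (1 - s) * F y + s * F z + \<rho> / 2 * (s * (1 - s) * (norm (y - z))\<^sup>2)"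
proof -
  define w where "w = (1 - s) *\<^sub>R y + s *\<^sub>R z"
  have "w \<in> X"
    unfolding w_def using X yz s by (simp add: convex_alt)
  then obtain \<zeta> where \<zeta>: "\<And>v. v \<in> X \<Longrightarrow> F w + \<zeta> \<bullet> (v - w) - \<rho> / 2 * (norm (v - w))\<^sup>2 \<le> F v"
    using sub by blast
  have yw: "y - w = s *\<^sub>R (y - z)" and zw: "z - w = - ((1 - s) *\<^sub>R (y - z))"
    by (simp_all add: w_def algebra_simps)
  have "(1 - s) * (F w + \<zeta> \<bullet> (y - w) - \<rho> / 2 * (norm (y - w))\<^sup>2) \<le> (1 - s) * F y"
    using \<zeta>[OF yz(1)] s by (intro mult_left_mono) auto
  moreover have "s * (F w + \<zeta> \<bullet> (z - w) - \<rho> / 2 * (norm (z - w))\<^sup>2) \<le> s * F z"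
    using \<zeta>[OF yz(2)] s by (intro mult_left_mono) auto
  moreover have "(1 - s) * (F w + \<zeta> \<bullet> (y - w) - \<rho> / 2 * (norm (y - w))\<^sup>2)
      + s * (F w + \<zeta> \<bullet> (z - w) - \<rho> / 2 * (norm (z - w))\<^sup>2)
    = F w - \<rho> / 2 * (s * (1 - s) * (norm (y - z))\<^sup>2)"
    unfolding yw zw norm_minus_cancel norm_scaleR power_mult_distrib power2_abs
      inner_minus_right inner_scaleR_right
    by algebra
  ultimately show ?thesis
    unfolding w_def by linarith
qed

text \<open>Projection onto \<open>X\<close> is nonexpansive and fixes \<open>y\<close>; the rest is
  expanding the square.\<close>

lemma closest_point_step:
  fixes X :: "'a::euclidean_space set"
  assumes "closed X" "convex X" "y \<in> X" "norm \<zeta> \<le> M"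
  shows "(norm (closest_point X (x - \<eta> *\<^sub>R \<zeta>) - y))\<^sup>2
    \<le> (norm (x - y))\<^sup>2 - 2 * \<eta> * (\<zeta> \<bullet> (x - y)) + \<eta>\<^sup>2 * M\<^sup>2"
proof -
  have "dist (closest_point X (x - \<eta> *\<^sub>R \<zeta>)) (closest_point X y) \<le> dist (x - \<eta> *\<^sub>R \<zeta>) y"
    using assms by (intro closest_point_lipschitz) auto
  then have "norm (closest_point X (x - \<eta> *\<^sub>R \<zeta>) - y) \<le> norm ((x - y) - \<eta> *\<^sub>R \<zeta>)"
    using assms(3) by (simp add: closest_point_self dist_norm algebra_simps)
  then have "(norm (closest_point X (x - \<eta> *\<^sub>R \<zeta>) - y))\<^sup>2 \<le> (norm ((x - y) - \<eta> *\<^sub>R \<zeta>))\<^sup>2"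
    by (rule power_mono) simp
  also have "\<dots> = (norm (x - y))\<^sup>2 - 2 * \<eta> * (\<zeta> \<bullet> (x - y)) + \<eta>\<^sup>2 * (norm \<zeta>)\<^sup>2"
    unfolding power2_norm_eq_inner
    by (simp add: inner_simps inner_commute algebra_simps power2_eq_square)
  also have "\<eta>\<^sup>2 * (norm \<zeta>)\<^sup>2 \<le> \<eta>\<^sup>2 * M\<^sup>2"
    using assms(4) by (intro mult_left_mono power_mono) auto
  finally show ?thesis by simp
qed

text \<open>Dividing \<open>- (c * s\<^sup>2) \<le> s * H y\<close> by \<open>s\<close> and letting
  \<open>s\<close> tend to 0 removes the second-order loss. This serves as the first-order
  optimality condition at a minimiser \<open>p\<close>, without derivatives.\<close>

lemma nonneg_if_secant_and_quadratic_minorant: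
  fixes H :: "'a::real_inner \<Rightarrow> real"
  assumes min: "\<And>s. 0 < s \<Longrightarrow> s \<le> 1 \<Longrightarrow> - (c * s\<^sup>2) \<le> H ((1 - s) *\<^sub>R p + s *\<^sub>R y)"
    and sec: "\<And>s. 0 < s \<Longrightarrow> s \<le> 1 \<Longrightarrow> H ((1 - s) *\<^sub>R p + s *\<^sub>R y) \<le> s * H y"
  shows "0 \<le> H y"
proof -
  have "- (c * s) \<le> H y" if "0 < s" "s \<le> 1" for s
  proof -
    have "s * (- (c * s)) \<le> s * H y"
      using min[OF that] sec[OF that] by (simp add: power2_eq_square algebra_simps)
    then show ?thesis using that(1) by (simp only: mult_le_cancel_left_pos)
  qed
  then have "\<forall>\<^sub>F s in at_right 0. - (c * s) \<le> H y"
    by (intro eventually_at_rightI[of 0 1]) auto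
  moreover have "((\<lambda>s. - (c * s)) \<longlongrightarrow> - (c * 0)) (at_right 0)"
    by (intro tendsto_intros)
  ultimately have "- (c * 0) \<le> H y"
    by (intro tendsto_upperbound) auto
  then show ?thesis by simp
qed

section \<open>Proximal points under a Slater condition\<close>

text \<open>A real-valued setting in which subgradients appear only through the global inequalities
  they satisfy on \<open>X\<close>.\<close>

locale slater_prox =
  fixes X :: "'a::euclidean_space set" and F G :: "'a \<Rightarrow> real" and M D \<rho> \<rho>h :: real and xf :: 'a
  assumes X_closed: "closed X" and X_convex: "convex X"
    and F_sub: "\<And>w. w \<in> X \<Longrightarrow> \<exists>\<zeta>. norm \<zeta> \<le> M \<and>
      (\<forall>y\<in>X. F w + \<zeta> \<bullet> (y - w) - \<rho> / 2 * (norm (y - w))\<^sup>2 \<le> F y)"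
    and G_sub: "\<And>w. w \<in> X \<Longrightarrow> \<exists>\<zeta>. \<forall>y\<in>X. G w + \<zeta> \<bullet> (y - w) \<le> G y"
    and xf: "xf \<in> X" "G xf < 0"
    and diameter: "\<And>y z. y \<in> X \<Longrightarrow> z \<in> X \<Longrightarrow> norm (y - z) \<le> D"
    and \<rho>: "0 \<le> \<rho>" "\<rho> < \<rho>h" and M_pos: "0 < M" and D_pos: "0 < D"
begin

text \<open>This is \<Lambda>: the numerator bounds the gap function of \<open>prox_growth\<close>
  at the Slater point, and the denominator is the slack there.\<close>

definition multiplier :: real where
  "multiplier = (M * D + \<rho>h * D\<^sup>2) / (- G xf)"

definition is_prox :: "'a \<Rightarrow> 'a \<Rightarrow> bool" where
  "is_prox x p \<longleftrightarrow> p \<in> X \<and> G p \<le> 0 \<and> (\<forall>y\<in>X. G y \<le> 0 \<longrightarrow>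
     F p + \<rho>h / 2 * (norm (p - x))\<^sup>2 \<le> F y + \<rho>h / 2 * (norm (y - x))\<^sup>2)"

lemma multiplier_pos: "0 < multiplier"
  unfolding multiplier_def using xf \<rho> M_pos D_pos by (intro divide_pos_pos add_pos_pos mult_pos_pos) auto

lemma F_secant:
  assumes "y \<in> X" "z \<in> X" "0 \<le> s" "s \<le> 1"
  shows "F ((1 - s) *\<^sub>R y + s *\<^sub>R z)
    \<le> (1 - s) * F y + s * F z + \<rho> / 2 * (s * (1 - s) * (norm (y - z))\<^sup>2)"
  by (rule weakly_convex_secant[OF X_convex _ assms]) (use F_sub in blast)

lemma G_secant:
  assumes "y \<in> X" "z \<in> X" "0 \<le> s" "s \<le> 1"
  shows "G ((1 - s) *\<^sub>R y + s *\<^sub>R z) \<le> (1 - s) * G y + s * G z"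
  using weakly_convex_secant[OF X_convex _ assms, of G 0] G_sub by simp

text \<open>The gap \<open>H\<close> between the objective and its quadratic minorant at \<open>p\<close> is convex, because the
  quadratic terms combine to curvature exactly \<open>\<rho>\<close>. Convexity on the segment from an infeasible \<open>x\<close>
  to the Slater point then bounds \<open>H x\<close> from below; this replaces the Lagrange multiplier of the
  constraint.\<close>

lemma prox_growth:
  assumes x: "x \<in> X" and p: "is_prox x p" and e: "0 \<le> e" "G x \<le> e"
  shows "F p + (\<rho>h - \<rho> / 2) * (norm (x - p))\<^sup>2 - multiplier * e \<le> F x"
proof -
  define H where "H y = F y + \<rho>h / 2 * (norm (y - x))\<^sup>2 - (\<rho>h - \<rho>) / 2 * (norm (y - p))\<^sup>2
    - (F p + \<rho>h / 2 * (norm (p - x))\<^sup>2)" for y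
  have pX: "p \<in> X" and Gp: "G p \<le> 0"
    using p by (auto simp: is_prox_def)
  have H_secant: "H ((1 - s) *\<^sub>R y + s *\<^sub>R z) \<le> (1 - s) * H y + s * H z"
    if "y \<in> X" "z \<in> X" "0 \<le> s" "s \<le> 1" for y z s
  proof -
    have "(1 - s) * H y + s * H z - H ((1 - s) *\<^sub>R y + s *\<^sub>R z)
      = (1 - s) * F y + s * F z + \<rho> / 2 * (s * (1 - s) * (norm (y - z))\<^sup>2) - F ((1 - s) *\<^sub>R y + s *\<^sub>R z)"
      unfolding H_def norm_convex_combination_diff_square by (simp add: field_simps)
    then show ?thesis
      using F_secant[OF that] by linarith
  qed
  have Hp: "H p = 0"
    by (simp add: H_def)
  \<comment> \<open>Minimality of \<open>p\<close> alone gives a lower bound on \<open>H\<close>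
    that is negative but quadratic in the distance to \<open>p\<close>. Convexity of
    \<open>H\<close> along the segment from \<open>p\<close> to \<open>y\<close> upgrades it to
    nonnegativity.\<close>
  have H_feas: "0 \<le> H y" if y: "y \<in> X" "G y \<le> 0" for y
  proof (rule nonneg_if_secant_and_quadratic_minorant[where H = H and p = p and c = "(\<rho>h - \<rho>) / 2 * (norm (y - p))\<^sup>2"])
    fix s :: real assume s: "0 < s" "s \<le> 1"
    let ?w = "(1 - s) *\<^sub>R p + s *\<^sub>R y"
    have "?w \<in> X"
      using X_convex pX y s by (simp add: convex_alt)
    moreover have "G ?w \<le> 0"
    proof -
      have "(1 - s) * G p \<le> 0" "s * G y \<le> 0"
        using s Gp y by (auto intro: mult_nonneg_nonpos)
      then show ?thesis
        using G_secant[of p y s] pX y s by linarith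
    qed
    ultimately have "F p + \<rho>h / 2 * (norm (p - x))\<^sup>2 \<le> F ?w + \<rho>h / 2 * (norm (?w - x))\<^sup>2"
      using p by (auto simp: is_prox_def)
    then have "- ((\<rho>h - \<rho>) / 2 * (norm (?w - p))\<^sup>2) \<le> H ?w"
      unfolding H_def by linarith
    moreover have "?w - p = s *\<^sub>R (y - p)"
      by (simp add: algebra_simps)
    ultimately show "- (((\<rho>h - \<rho>) / 2 * (norm (y - p))\<^sup>2) * s\<^sup>2) \<le> H ?w"
      by (simp only: power_mult_distrib norm_scaleR power2_abs mult_ac)
    show "H ?w \<le> s * H y"
      using H_secant[of p y s] pX y s Hp by simp
  qed
  have "- (multiplier * e) \<le> H x"
  proof (cases "G x \<le> 0")
    case True
    then show ?thesis
      using H_feas[OF x] multiplier_pos e mult_nonneg_nonneg[of multiplier e] by linarith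
  next
    case False
    \<comment> \<open>The subgradient at \<open>xf\<close>, tested at \<open>p\<close>, bounds
      \<open>F xf - F p\<close> by \<open>M * D + \<rho> / 2 * D\<^sup>2\<close>. The proximal term
      at \<open>xf\<close> adds at most \<open>\<rho>h / 2 * D\<^sup>2\<close>, and the subtracted
      squares are dropped.\<close>
    have Hxf: "H xf \<le> M * D + \<rho>h * D\<^sup>2"
    proof -
      obtain \<zeta> where \<zeta>: "norm \<zeta> \<le> M"
        "F xf + \<zeta> \<bullet> (p - xf) - \<rho> / 2 * (norm (p - xf))\<^sup>2 \<le> F p"
        using F_sub[OF xf(1)] pX by blast
      have "\<bar>\<zeta> \<bullet> (p - xf)\<bar> \<le> norm \<zeta> * norm (p - xf)"
        by (rule Cauchy_Schwarz_ineq2)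
      also have "\<dots> \<le> M * D"
        using \<zeta>(1) diameter[OF pX xf(1)] M_pos by (intro mult_mono) auto
      finally have 1: "- (\<zeta> \<bullet> (p - xf)) \<le> M * D"
        by linarith
      have 2: "\<rho>h / 2 * (norm (xf - x))\<^sup>2 \<le> \<rho>h / 2 * D\<^sup>2"
        using diameter[OF xf(1) x] \<rho> by (intro mult_left_mono power_mono) auto
      have 3: "\<rho> / 2 * (norm (p - xf))\<^sup>2 \<le> \<rho> / 2 * D\<^sup>2"
        using diameter[OF pX xf(1)] \<rho> by (intro mult_left_mono power_mono) auto
      have 4: "\<rho> / 2 * D\<^sup>2 \<le> \<rho>h / 2 * D\<^sup>2"
        using \<rho> by (intro mult_right_mono) auto
      have 5: "0 \<le> (\<rho>h - \<rho>) / 2 * (norm (xf - p))\<^sup>2" "0 \<le> \<rho>h / 2 * (norm (p - x))\<^sup>2"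
        using \<rho> by auto
      show ?thesis
        unfolding H_def using \<zeta>(2) 1 2 3 4 5 by linarith
    qed
    \<comment> \<open>The zero of the linear interpolation between \<open>G x\<close> and
      \<open>G xf\<close>, so that convexity of \<open>G\<close> makes \<open>?w\<close>
      feasible.\<close>
    define s where "s = G x / (G x - G xf)"
    have s: "0 \<le> s" "s < 1"
      using False xf by (auto simp: s_def)
    have s_eq: "(1 - s) * G x + s * G xf = 0"
      using False xf by (simp add: s_def field_simps)
    let ?w = "(1 - s) *\<^sub>R x + s *\<^sub>R xf"
    have "?w \<in> X"
      using X_convex x xf s by (simp add: convex_alt)
    moreover have "G ?w \<le> 0"
      using G_secant[OF x xf(1), of s] s s_eq by simp
    ultimately have "0 \<le> (1 - s) * H x + s * H xf"
      using H_feas[of ?w] H_secant[OF x xf(1), of s] s by linarith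
    moreover have "s = (1 - s) * (G x / (- G xf))"
      using s_eq xf by (simp add: field_simps)
    then have "s * H xf = (1 - s) * (G x / (- G xf)) * H xf"
      by (rule arg_cong[where f = "\<lambda>r. r * H xf"])
    ultimately have "0 \<le> (1 - s) * (H x + G x / (- G xf) * H xf)"
      unfolding distrib_left mult.assoc by linarith
    then have "0 \<le> H x + G x / (- G xf) * H xf"
      using s by (simp add: zero_le_mult_iff)
    also have "G x / (- G xf) * H xf \<le> G x / (- G xf) * (M * D + \<rho>h * D\<^sup>2)"
      using False xf Hxf by (intro mult_left_mono divide_nonneg_pos) auto
    also have "\<dots> = multiplier * G x"
      by (simp add: multiplier_def)
    also have "\<dots> \<le> multiplier * e"
      using e multiplier_pos by (intro mult_left_mono) auto
    finally show ?thesis by simp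
  qed
  moreover have "H x = F x - F p - (\<rho>h - \<rho> / 2) * (norm (x - p))\<^sup>2"
    unfolding H_def norm_minus_commute[of p x] diff_self norm_zero by (simp add: field_simps)
  ultimately show ?thesis
    by linarith
qed

text \<open>The Moreau envelope \<open>\<phi>\<close> of the constrained problem telescopes although the comparison point
  \<open>p t\<close> moves. Testing the minimality of \<open>p S\<close> with \<open>p T\<close> cancels the values of \<open>F\<close>, so the total
  decrease of \<open>\<phi>\<close> is at most \<open>\<rho>h / 2 * D\<^sup>2\<close>.\<close>

lemma sum_inner_prox_le:
  assumes ST: "S \<le> T"
    and x: "\<And>t. t \<le> T \<Longrightarrow> x t \<in> X"
    and p: "\<And>t. t \<le> T \<Longrightarrow> is_prox (x t) (p t)"
    and \<zeta>: "\<And>t. t < T \<Longrightarrow> norm (\<zeta> t) \<le> M"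
    and step: "\<And>t. t < T \<Longrightarrow> x (Suc t) = closest_point X (x t - \<eta> t *\<^sub>R \<zeta> t)"
  shows "(\<Sum>t\<in>{S..<T}. \<eta> t * (\<zeta> t \<bullet> (x t - p t)))
    \<le> D\<^sup>2 / 2 + M\<^sup>2 / 2 * (\<Sum>t\<in>{S..<T}. (\<eta> t)\<^sup>2)"
proof -
  define \<phi> where "\<phi> t = F (p t) + \<rho>h / 2 * (norm (p t - x t))\<^sup>2" for t
  have \<phi>_le: "\<phi> t \<le> F (p s) + \<rho>h / 2 * (norm (p s - x t))\<^sup>2" if "s \<le> T" "t \<le> T" for s t
    using p[OF that(1)] p[OF that(2)] by (auto simp: is_prox_def \<phi>_def)
  \<comment> \<open>The old proximal point \<open>p t\<close> is a feasible competitor in the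
    problem centred at \<open>x (Suc t)\<close>.\<close>
  have \<phi>_step: "\<phi> (Suc t) - \<phi> t \<le> \<rho>h * (M\<^sup>2 / 2 * (\<eta> t)\<^sup>2 - \<eta> t * (\<zeta> t \<bullet> (x t - p t)))"
    if t: "t < T" for t
  proof -
    have "(norm (x (Suc t) - p t))\<^sup>2
      \<le> (norm (x t - p t))\<^sup>2 - 2 * \<eta> t * (\<zeta> t \<bullet> (x t - p t)) + (\<eta> t)\<^sup>2 * M\<^sup>2"
      unfolding step[OF t] using p[of t] t
      by (intro closest_point_step X_closed X_convex \<zeta>) (auto simp: is_prox_def)
    then have "\<rho>h / 2 * (norm (p t - x (Suc t)))\<^sup>2 \<le> \<rho>h / 2 *
      ((norm (p t - x t))\<^sup>2 - 2 * \<eta> t * (\<zeta> t \<bullet> (x t - p t)) + (\<eta> t)\<^sup>2 * M\<^sup>2)"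
      using \<rho> by (intro mult_left_mono) (auto simp: norm_minus_commute)
    then show ?thesis
      using \<phi>_le[of t "Suc t"] t by (simp add: \<phi>_def field_simps)
  qed
  have "\<phi> T - \<phi> S = (\<Sum>t\<in>{S..<T}. \<phi> (Suc t) - \<phi> t)"
    using ST by (simp add: sum_Suc_diff')
  also have "\<dots> \<le> (\<Sum>t\<in>{S..<T}. \<rho>h * (M\<^sup>2 / 2 * (\<eta> t)\<^sup>2 - \<eta> t * (\<zeta> t \<bullet> (x t - p t))))"
    by (intro sum_mono \<phi>_step) auto
  also have "\<dots> = \<rho>h * (M\<^sup>2 / 2 * (\<Sum>t\<in>{S..<T}. (\<eta> t)\<^sup>2)
      - (\<Sum>t\<in>{S..<T}. \<eta> t * (\<zeta> t \<bullet> (x t - p t))))"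
    by (simp only: sum_subtractf flip: sum_distrib_left)
  finally have 1: "\<phi> T - \<phi> S \<le> \<dots>" .
  have "\<rho>h / 2 * (norm (p T - x S))\<^sup>2 \<le> \<rho>h / 2 * D\<^sup>2"
    using diameter[of "p T" "x S"] p[of T] x[of S] ST \<rho>
    by (intro mult_left_mono power_mono) (auto simp: is_prox_def)
  moreover have "0 \<le> \<rho>h / 2 * (norm (p T - x T))\<^sup>2"
    using \<rho> by simp
  ultimately have "\<phi> S - \<phi> T \<le> \<rho>h * (D\<^sup>2 / 2)"
    using \<phi>_le[of T S] ST by (simp add: \<phi>_def)
  with 1 have "0 \<le> \<rho>h * (D\<^sup>2 / 2 + M\<^sup>2 / 2 * (\<Sum>t\<in>{S..<T}. (\<eta> t)\<^sup>2)
      - (\<Sum>t\<in>{S..<T}. \<eta> t * (\<zeta> t \<bullet> (x t - p t))))"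
    by (simp add: algebra_simps)
  then show ?thesis
    using \<rho> by (simp add: zero_le_mult_iff)
qed

text \<open>Each step, of either kind, is charged \<open>\<eta> t * tol t\<close>, and these charges
  together exceed the available budget. The objective steps must make up the deficit; strictness of
  the conclusion also excludes an empty \<open>I\<close>.\<close>

lemma sum_prox_distance_less:
  assumes ST: "S \<le> T"
    and x: "\<And>t. t \<le> T \<Longrightarrow> x t \<in> X"
    and p: "\<And>t. t \<le> T \<Longrightarrow> is_prox (x t) (p t)"
    and \<zeta>: "\<And>t. t < T \<Longrightarrow> norm (\<zeta> t) \<le> M"
    and step: "\<And>t. t < T \<Longrightarrow> x (Suc t) = closest_point X (x t - \<eta> t *\<^sub>R \<zeta> t)"
    and \<zeta>_F: "\<And>t y. t < T \<Longrightarrow> G (x t) \<le> tol t \<Longrightarrow> y \<in> X \<Longrightarrow>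
      F (x t) + \<zeta> t \<bullet> (y - x t) - \<rho> / 2 * (norm (y - x t))\<^sup>2 \<le> F y"
    and \<zeta>_G: "\<And>t y. t < T \<Longrightarrow> \<not> G (x t) \<le> tol t \<Longrightarrow> y \<in> X \<Longrightarrow>
      G (x t) + \<zeta> t \<bullet> (y - x t) \<le> G y"
    and tol: "\<And>t. 0 \<le> tol t" and \<eta>: "\<And>t. 0 < \<eta> t"
    and e: "\<And>t. S \<le> t \<Longrightarrow> t < T \<Longrightarrow> tol t \<le> e"
    and budget: "D\<^sup>2 / 2 + M\<^sup>2 / 2 * (\<Sum>t\<in>{S..<T}. (\<eta> t)\<^sup>2) < (\<Sum>t\<in>{S..<T}. \<eta> t * tol t)"
    and I: "I = {t\<in>{S..<T}. G (x t) \<le> tol t}"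
  shows "(\<Sum>t\<in>I. \<eta> t * ((\<rho>h - \<rho>) * (norm (p t - x t))\<^sup>2)) < (\<Sum>t\<in>I. \<eta> t * ((1 + multiplier) * e))"
proof -
  have lower: "\<eta> t * tol t + (if t \<in> I then
      \<eta> t * ((\<rho>h - \<rho>) * (norm (p t - x t))\<^sup>2) - \<eta> t * ((1 + multiplier) * e) else 0)
      \<le> \<eta> t * (\<zeta> t \<bullet> (x t - p t))" if t: "t \<in> {S..<T}" for t
  proof -
    have pt: "p t \<in> X" "G (p t) \<le> 0"
      using p[of t] t by (auto simp: is_prox_def)
    have inner: "\<zeta> t \<bullet> (p t - x t) = - (\<zeta> t \<bullet> (x t - p t))"
      by (simp add: inner_diff_right)
    show ?thesis
    proof (cases "t \<in> I")
      case True
      then have "G (x t) \<le> tol t" by (simp add: I)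
      then have "F (p t) + (\<rho>h - \<rho> / 2) * (norm (x t - p t))\<^sup>2 - multiplier * tol t \<le> F (x t)"
        using t by (intro prox_growth x p tol) auto
      moreover have "F (x t) + \<zeta> t \<bullet> (p t - x t) - \<rho> / 2 * (norm (p t - x t))\<^sup>2 \<le> F (p t)"
        using \<open>G (x t) \<le> tol t\<close> t pt by (intro \<zeta>_F) auto
      ultimately have "(\<rho>h - \<rho>) * (norm (p t - x t))\<^sup>2 - multiplier * tol t \<le> \<zeta> t \<bullet> (x t - p t)"
        unfolding inner by (simp add: norm_minus_commute field_simps)
      moreover have "(1 + multiplier) * tol t \<le> (1 + multiplier) * e"
        using e t multiplier_pos by (intro mult_left_mono) auto
      \<comment> \<open>The extra \<open>tol t\<close> on the left is the common charge; it accounts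
        for the 1 in \<open>1 + multiplier\<close>.\<close>
      ultimately have "tol t + ((\<rho>h - \<rho>) * (norm (p t - x t))\<^sup>2 - (1 + multiplier) * e)
          \<le> \<zeta> t \<bullet> (x t - p t)"
        by (simp add: algebra_simps)
      then have "\<eta> t * (tol t + ((\<rho>h - \<rho>) * (norm (p t - x t))\<^sup>2 - (1 + multiplier) * e))
          \<le> \<eta> t * (\<zeta> t \<bullet> (x t - p t))"
        using \<eta>[of t] by (intro mult_left_mono) auto
      then show ?thesis
        using True by (simp add: right_diff_distrib distrib_left del: mult_le_cancel_left_pos)
    next
      case False
      then have Gt: "\<not> G (x t) \<le> tol t" using t by (simp add: I)
      then have "G (x t) + \<zeta> t \<bullet> (p t - x t) \<le> G (p t)"
        using t pt by (intro \<zeta>_G) auto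
      then have "tol t \<le> \<zeta> t \<bullet> (x t - p t)"
        using Gt pt inner by linarith
      then show ?thesis
        using False \<eta>[of t] by simp
    qed
  qed
  have I_Int: "{S..<T} \<inter> I = I"
    by (auto simp: I)
  have "(\<Sum>t\<in>{S..<T}. \<eta> t * tol t) + (\<Sum>t\<in>I. \<eta> t * ((\<rho>h - \<rho>) * (norm (p t - x t))\<^sup>2)
      - \<eta> t * ((1 + multiplier) * e))
    = (\<Sum>t\<in>{S..<T}. \<eta> t * tol t + (if t \<in> I then
      \<eta> t * ((\<rho>h - \<rho>) * (norm (p t - x t))\<^sup>2) - \<eta> t * ((1 + multiplier) * e) else 0))"
    unfolding sum.distrib sum.inter_restrict[OF finite_atLeastLessThan, symmetric] by (simp only: I_Int)
  also have "\<dots> \<le> (\<Sum>t\<in>{S..<T}. \<eta> t * (\<zeta> t \<bullet> (x t - p t)))"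
    by (intro sum_mono lower)
  also have "\<dots> \<le> D\<^sup>2 / 2 + M\<^sup>2 / 2 * (\<Sum>t\<in>{S..<T}. (\<eta> t)\<^sup>2)"
    using ST x p \<zeta> step by (rule sum_inner_prox_le)
  also note budget
  finally show ?thesis
    by (simp add: sum_subtractf)
qed

end

section \<open>Finite values, the output law and existence of proximal points\<close>

text \<open>An infinite value at \<open>x\<close> absorbs the real increment, so the defining
  condition is the same for every vector.\<close>

lemma subdiff_at_infinity:
  assumes "h x = \<infinity>" "\<zeta> \<in> subdiff h x"
  shows "\<xi> \<in> subdiff h x"
  using assms by (simp add: subdiff_def split: if_splits) blast

lemma finite_if_subdiff_bounded:
  fixes h :: "real^'d \<Rightarrow> ereal"
  assumes "h x \<noteq> -\<infinity>" "subdiff h x \<noteq> {}" "\<forall>\<zeta>\<in>subdiff h x. norm \<zeta> \<le> M"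
  shows "\<bar>h x\<bar> \<noteq> \<infinity>"
proof
  assume "\<bar>h x\<bar> = \<infinity>"
  then have "h x = \<infinity>"
    using assms(1) by (cases "h x") auto
  moreover obtain \<xi> :: "real^'d" where "norm \<xi> = \<bar>M\<bar> + 1"
    using vector_choose_size[of "\<bar>M\<bar> + 1"] by auto
  ultimately show False
    using subdiff_at_infinity[of h x _ \<xi>] assms by fastforce
qed

lemma weakly_convex_on_real:
  assumes "weakly_convex_on \<rho> X h" and fin: "\<And>y. y \<in> X \<Longrightarrow> h y = ereal (r y)"
    and "w \<in> X" "y \<in> X" "\<zeta> \<in> subdiff h w"
  shows "r w + \<zeta> \<bullet> (y - w) - \<rho> / 2 * (norm (y - w))\<^sup>2 \<le> r y"
proof -
  have "h w + ereal (\<zeta> \<bullet> (y - w) - \<rho> / 2 * (norm (y - w))\<^sup>2) \<le> h y"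
    using assms by (auto simp: weakly_convex_on_def)
  then show ?thesis
    by (simp add: fin assms(3,4))
qed

text \<open>\<open>embed_pmf\<close> has the prescribed weights once they are nonnegative with total
  mass one, which positive stepsizes and a finite nonempty \<open>I\<close> ensure.\<close>

lemma expectation_output_index:
  fixes h :: "nat \<Rightarrow> real"
  assumes I: "finite I" "I \<noteq> {}" and \<eta>: "\<And>t. 0 < \<eta> t"
  shows "measure_pmf.expectation (output_index I \<eta>) h = (\<Sum>t\<in>I. \<eta> t * h t) / (\<Sum>t\<in>I. \<eta> t)"
proof -
  let ?w = "\<lambda>t. if t \<in> I then \<eta> t / (\<Sum>s\<in>I. \<eta> s) else 0"
  have pos: "0 < (\<Sum>s\<in>I. \<eta> s)"
    using I \<eta> by (intro sum_pos) auto
  have nonneg: "0 \<le> ?w t" for t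
    using pos \<eta>[of t] by (simp add: less_imp_le)
  have "(\<integral>\<^sup>+ t. ennreal (?w t) \<partial>count_space UNIV) = (\<integral>\<^sup>+ t. ennreal (?w t) \<partial>count_space I)"
    by (subst nn_integral_count_space_indicator) (auto intro!: nn_integral_cong)
  also have "\<dots> = (\<Sum>t\<in>I. ennreal (?w t))"
    using I(1) by (rule nn_integral_count_space_finite)
  also have "\<dots> = ennreal (\<Sum>t\<in>I. ?w t)"
    using nonneg by (rule sum_ennreal)
  also have "(\<Sum>t\<in>I. ?w t) = 1"
    using pos by (simp add: sum_divide_distrib[symmetric])
  finally have pmf: "pmf (output_index I \<eta>) t = ?w t" for t
    unfolding output_index_def using nonneg by (intro pmf_embed_pmf) auto
  have "measure_pmf.expectation (output_index I \<eta>) h = (\<Sum>t\<in>I. pmf (output_index I \<eta>) t *\<^sub>R h t)"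
    using I by (intro integral_measure_pmf) (auto simp: set_pmf_iff pmf)
  then show ?thesis
    by (simp add: pmf sum_divide_distrib)
qed

text \<open>The choice in \<open>arg_min\<close> has the minimising property as soon as some
  minimiser exists. The feasible set is compact and contains the Slater point, and the objective is
  continuous on it.\<close>

lemma is_prox_prox_point:
  fixes X :: "(real^'d) set"
  assumes "slater_prox X F G M D \<rho> \<rho>h xf"
    and f: "\<And>y. y \<in> X \<Longrightarrow> f y = ereal (F y)" and g: "\<And>y. y \<in> X \<Longrightarrow> g y = ereal (G y)"
    and cont: "continuous_on X F" "continuous_on X G"
  shows "slater_prox.is_prox X F G \<rho>h x (prox_point \<rho>h X f g x)"
proof -
  interpret slater_prox X F G M D \<rho> \<rho>h xf by fact
  let ?obj = "\<lambda>y. f y + ereal (\<rho>h / 2 * (norm (y - x))\<^sup>2)"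
  have "bounded X"
    using diameter by (auto simp: bounded_two_points dist_norm)
  then have "compact X"
    using X_closed by (simp add: compact_eq_bounded_closed)
  moreover have "closed {y \<in> X. G y \<le> 0}"
  proof -
    have "{y \<in> X. G y \<le> 0} = X \<inter> G -` {..0}"
      by auto
    then show ?thesis
      using continuous_closed_preimage[OF cont(2) X_closed, of "{..0}"] by simp
  qed
  ultimately have "compact (X \<inter> {y \<in> X. G y \<le> 0})"
    by (rule compact_Int_closed)
  moreover have "X \<inter> {y \<in> X. G y \<le> 0} = {y \<in> X. G y \<le> 0}"
    by blast
  ultimately have "compact {y \<in> X. G y \<le> 0}"
    by simp
  moreover have "xf \<in> {y \<in> X. G y \<le> 0}"
    using xf by simp
  moreover have "continuous_on {y \<in> X. G y \<le> 0} (\<lambda>y. F y + \<rho>h / 2 * (norm (y - x))\<^sup>2)"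
    by (intro continuous_intros continuous_on_subset[OF cont(1)]) auto
  ultimately obtain p where p: "p \<in> X" "G p \<le> 0"
      "\<And>y. y \<in> X \<Longrightarrow> G y \<le> 0 \<Longrightarrow> F p + \<rho>h / 2 * (norm (p - x))\<^sup>2 \<le> F y + \<rho>h / 2 * (norm (y - x))\<^sup>2"
    using continuous_attains_inf[of "{y \<in> X. G y \<le> 0}"] by blast
  have "is_arg_min ?obj (\<lambda>y. y \<in> X \<and> g y \<le> 0) p"
    using p by (auto simp: is_arg_min_linorder f g)
  then have "is_arg_min ?obj (\<lambda>y. y \<in> X \<and> g y \<le> 0) (prox_point \<rho>h X f g x)"
    unfolding prox_point_def arg_min_def by (rule someI)
  then show ?thesis
    by (auto simp: is_arg_min_linorder is_prox_def f g)
qed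

section \<open>Budgets of the two stepsize schedules\<close>

text \<open>There are at most \<open>T div 2 + 1\<close> terms, each at most
  \<open>1 / (T div 2 + 1)\<close>, and at least \<open>T / 2\<close> terms, each at least
  \<open>1 / T\<close>.\<close>

lemma sum_inverse_upper_half:
  assumes "0 < T"
  shows "(\<Sum>t\<in>{T div 2..<T}. 1 / (real t + 1)) \<le> 1"
    and "1 / 2 \<le> (\<Sum>t\<in>{T div 2..<T}. 1 / (real t + 1))"
proof -
  have "(\<Sum>t\<in>{T div 2..<T}. 1 / (real t + 1)) \<le> real (card {T div 2..<T}) * (1 / real (T div 2 + 1))"
    by (rule sum_bounded_above) (auto intro!: divide_left_mono)
  also have "\<dots> \<le> 1"
  proof -
    have "card {T div 2..<T} \<le> T div 2 + 1" by simp
    then have "real (card {T div 2..<T}) \<le> real (T div 2 + 1)" by (simp only: of_nat_le_iff)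
    then show ?thesis by (simp add: divide_le_eq)
  qed
  finally show "(\<Sum>t\<in>{T div 2..<T}. 1 / (real t + 1)) \<le> 1" .
  have "real T \<le> 2 * real (T - T div 2)"
    by linarith
  then have "1 / 2 \<le> real (card {T div 2..<T}) * (1 / real T)"
    using assms by (simp add: field_simps)
  also have "\<dots> \<le> (\<Sum>t\<in>{T div 2..<T}. 1 / (real t + 1))"
    by (rule sum_bounded_below) (use assms in \<open>auto intro!: divide_left_mono\<close>)
  finally show "1 / 2 \<le> (\<Sum>t\<in>{T div 2..<T}. 1 / (real t + 1))" .
qed

text \<open>In units of \<open>T * e\<^sup>2 / M\<^sup>2\<close>, both terms on the left are at most
  2/25, while the right side is 2/5.\<close>

lemma constant_step_budget:
  fixes M D e :: real
  assumes pos: "0 < M" "0 < e" "0 < T" and T: "25 * M\<^sup>2 * D\<^sup>2 / (4 * e\<^sup>2) \<le> real T"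
    and \<eta>: "\<And>t. \<eta> t = 2 * e / (5 * M\<^sup>2)" and tol: "\<And>t. tol t = e"
  shows "D\<^sup>2 / 2 + M\<^sup>2 / 2 * (\<Sum>t\<in>{0..<T}. (\<eta> t)\<^sup>2) < (\<Sum>t\<in>{0..<T}. \<eta> t * tol t)"
proof -
  define a where "a = e\<^sup>2 / M\<^sup>2"
  have "0 < a" using pos by (simp add: a_def)
  have "D\<^sup>2 \<le> 4 / 25 * (real T * a)"
    using T pos by (simp add: a_def field_simps)
  moreover have "M\<^sup>2 / 2 * (\<Sum>t\<in>{0..<T}. (\<eta> t)\<^sup>2) = 2 / 25 * (real T * a)"
    using pos by (simp add: \<eta> a_def field_simps power2_eq_square)
  moreover have "(\<Sum>t\<in>{0..<T}. \<eta> t * tol t) = 2 / 5 * (real T * a)"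
    by (simp add: \<eta> tol a_def power2_eq_square)
  moreover have "0 < real T * a"
    using \<open>0 < a\<close> pos by simp
  ultimately show ?thesis by linarith
qed

text \<open>By the bounds on the harmonic block, the left side is at most \<open>D\<^sup>2\<close>
  and the right side at least \<open>5 / 2 * D\<^sup>2\<close>.\<close>

lemma decreasing_step_budget:
  fixes M D :: real
  assumes pos: "0 < M" "0 < D" "0 < T"
    and \<eta>: "\<And>t. \<eta> t = D / (M * sqrt (real t + 1))" and tol: "\<And>t. tol t = 5 * M * D / sqrt (real t + 1)"
  shows "D\<^sup>2 / 2 + M\<^sup>2 / 2 * (\<Sum>t\<in>{T div 2..<T}. (\<eta> t)\<^sup>2) < (\<Sum>t\<in>{T div 2..<T}. \<eta> t * tol t)"
proof -
  define h where "h = (\<Sum>t\<in>{T div 2..<T}. 1 / (real t + 1))"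
  have "M\<^sup>2 / 2 * (\<eta> t)\<^sup>2 = D\<^sup>2 / 2 * (1 / (real t + 1))" for t
    using pos by (simp add: \<eta> power_divide power_mult_distrib)
  then have "M\<^sup>2 / 2 * (\<Sum>t\<in>{T div 2..<T}. (\<eta> t)\<^sup>2) = D\<^sup>2 / 2 * h"
    by (simp only: h_def sum_distrib_left)
  moreover have "\<eta> t * tol t = 5 * D\<^sup>2 * (1 / (real t + 1))" for t
    using pos by (simp add: \<eta> tol power2_eq_square)
  then have "(\<Sum>t\<in>{T div 2..<T}. \<eta> t * tol t) = 5 * D\<^sup>2 * h"
    by (simp only: h_def sum_distrib_left)
  moreover have "D\<^sup>2 / 2 * h \<le> D\<^sup>2 / 2 * 1" "5 * D\<^sup>2 * (1 / 2) \<le> 5 * D\<^sup>2 * h"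
    using sum_inverse_upper_half[OF pos(3)] unfolding h_def by (intro mult_left_mono; simp)+
  moreover have "0 < D\<^sup>2"
    using pos by simp
  ultimately show ?thesis by linarith
qed

lemma decreasing_tol_le:
  fixes M D e :: real
  assumes pos: "0 < M" "0 < D" "0 < e" and T: "50 * M\<^sup>2 * D\<^sup>2 / e\<^sup>2 \<le> real T" and t: "T div 2 \<le> t"
  shows "5 * M * D / sqrt (real t + 1) \<le> e"
proof -
  \<comment> \<open>Rounding down in \<open>T div 2\<close> costs one here, which the shift in
    \<open>t + 1\<close> absorbs. The factor 50 then becomes 25, the square of the 5 in the
    tolerance.\<close>
  have "T \<le> 2 * t + 1"
    using t by presburger
  then have "real T \<le> real (2 * t + 1)"
    by (simp only: of_nat_le_iff)
  also have "\<dots> \<le> 2 * (real t + 1)"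
    by simp
  finally have "50 * M\<^sup>2 * D\<^sup>2 / e\<^sup>2 \<le> 2 * (real t + 1)"
    by (rule order_trans[OF T])
  then have "50 * M\<^sup>2 * D\<^sup>2 \<le> 2 * (real t + 1) * e\<^sup>2"
    using pos by (simp only: pos_divide_le_eq zero_less_power)
  moreover have "(5 * M * D)\<^sup>2 = 25 * M\<^sup>2 * D\<^sup>2"
    by (simp add: power_mult_distrib)
  moreover have "(e * sqrt (real t + 1))\<^sup>2 = (real t + 1) * e\<^sup>2"
    by (simp add: power_mult_distrib)
  ultimately have "(5 * M * D)\<^sup>2 \<le> (e * sqrt (real t + 1))\<^sup>2"
    by linarith
  then have "5 * M * D \<le> e * sqrt (real t + 1)"
    by (rule power2_le_imp_le) (use pos in simp)
  then show ?thesis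
    by (simp add: pos_divide_le_eq)
qed

section \<open>Guarantees for the switching subgradient run\<close>

theorem theorem4p3:
  fixes X :: "(real^'d) set"
    and f g :: "real^'d \<Rightarrow> ereal"
    and x_feas :: "real^'d"
    and M D \<rho> \<rho>h \<Lambda> \<epsilon> :: real
    and S T :: nat
    and tol \<eta> :: "nat \<Rightarrow> real"
    and x :: "nat \<Rightarrow> real^'d"
    and I :: "nat set"
  assumes X: "closed X" "convex X"
    and values_f: "\<forall>y. f y \<noteq> -\<infinity>" and values_g: "\<forall>y. g y \<noteq> -\<infinity>"
    and cont: "continuous_on X f" "continuous_on X g"
    and subdiff_nonempty: "\<forall>y\<in>X. subdiff f y \<noteq> {}" "\<forall>y\<in>X. subdiff g y \<noteq> {}"
    and M_pos: "M > 0"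
    and subdiff_bound: "\<forall>y\<in>X. \<forall>\<zeta>\<in>subdiff f y. norm \<zeta> \<le> M"
                       "\<forall>y\<in>X. \<forall>\<zeta>\<in>subdiff g y. norm \<zeta> \<le> M"
    and f_weakly_convex: "weakly_convex_on \<rho> X f"
    and g_convex: "subgrad_convex_on X g"
    and slater: "x_feas \<in> rel_interior X" "g x_feas < 0"
    and D_pos: "D > 0"
    and diameter: "\<forall>y\<in>X. \<forall>y'\<in>X. norm (y - y') \<le> D"
    and \<rho>h: "\<rho>h > \<rho>"
    and \<Lambda>: "\<Lambda> = (M * D + \<rho>h * D\<^sup>2) / (- real_of_ereal (g x_feas))"
    and \<epsilon>: "\<epsilon> > 0"
    and T: "T > 0"
    and run: "switching_subgradient_run X f g T tol \<eta> x"
    and I: "I = index_set_I g S T tol x"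
    and cases:
      "(S = 0
        \<and> (\<forall>t. tol t = \<epsilon>\<^sup>2 * (\<rho>h - \<rho>) / (1 + \<Lambda>))
        \<and> (\<forall>t. \<eta> t = 2 * \<epsilon>\<^sup>2 * (\<rho>h - \<rho>) / (5 * (1 + \<Lambda>) * M\<^sup>2))
        \<and> real T \<ge> 25 * M\<^sup>2 * D\<^sup>2 * (1 + \<Lambda>)\<^sup>2 / (4 * \<epsilon>^4 * (\<rho>h - \<rho>)\<^sup>2))
     \<or> (S = T div 2
        \<and> (\<forall>t. tol t = 5 * M * D / sqrt (real t + 1))
        \<and> (\<forall>t. \<eta> t = D / (M * sqrt (real t + 1)))
        \<and> real T \<ge> 50 * M\<^sup>2 * D\<^sup>2 * (1 + \<Lambda>)\<^sup>2 / (\<epsilon>^4 * (\<rho>h - \<rho>)\<^sup>2))"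
  shows "I \<noteq> {}
    \<and> measure_pmf.expectation (output_index I \<eta>)
          (\<lambda>\<tau>. norm (prox_point \<rho>h X f g (x \<tau>) - x \<tau>)) \<le> \<epsilon>
    \<and> measure_pmf.expectation (output_index I \<eta>) (\<lambda>\<tau>. real_of_ereal (g (x \<tau>)))
        \<le> \<epsilon>\<^sup>2 * (\<rho>h - \<rho>) / (1 + \<Lambda>)"
proof -
  define F where "F = (\<lambda>y. real_of_ereal (f y))"
  define G where "G = (\<lambda>y. real_of_ereal (g y))"
  \<comment> \<open>Nonempty bounded subdifferentials force finite values on \<open>X\<close>, so
    the real parts \<open>F\<close> and \<open>G\<close> carry all the information there.\<close>
  have fin: "\<bar>f y\<bar> \<noteq> \<infinity>" "\<bar>g y\<bar> \<noteq> \<infinity>" if "y \<in> X" for y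
    using that values_f values_g subdiff_nonempty subdiff_bound
      finite_if_subdiff_bounded[of f y M] finite_if_subdiff_bounded[of g y M] by simp_all
  have f: "f y = ereal (F y)" and g: "g y = ereal (G y)" if "y \<in> X" for y
    using fin[OF that] by (auto simp: F_def G_def ereal_real)
  have contF: "continuous_on X F" and contG: "continuous_on X G"
    using cont fin by (auto simp: continuous_on_iff_real F_def G_def comp_def)
  have F_lower: "F w + \<zeta> \<bullet> (y - w) - \<rho> / 2 * (norm (y - w))\<^sup>2 \<le> F y"
    if "w \<in> X" "y \<in> X" "\<zeta> \<in> subdiff f w" for w y \<zeta>
    using weakly_convex_on_real[OF f_weakly_convex f that] by simp
  have G_lower: "G w + \<zeta> \<bullet> (y - w) \<le> G y"
    if "w \<in> X" "y \<in> X" "\<zeta> \<in> subdiff g w" for w y \<zeta>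
    using weakly_convex_on_real[OF g_convex[unfolded subgrad_convex_on_def] g that] by simp
  have feas: "x_feas \<in> X"
    using slater rel_interior_subset by blast
  interpret slater_prox X F G M D \<rho> \<rho>h x_feas
  proof
    show "\<exists>\<zeta>. norm \<zeta> \<le> M \<and>
      (\<forall>y\<in>X. F w + \<zeta> \<bullet> (y - w) - \<rho> / 2 * (norm (y - w))\<^sup>2 \<le> F y)" if "w \<in> X" for w
      using that subdiff_nonempty(1) subdiff_bound(1) F_lower[OF that] by blast
    show "\<exists>\<zeta>. \<forall>y\<in>X. G w + \<zeta> \<bullet> (y - w) \<le> G y" if "w \<in> X" for w
      using that subdiff_nonempty(2) G_lower[OF that] by blast
    show "G x_feas < 0"
      using slater(2) g[OF feas] by simp
    show "0 \<le> \<rho>"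
      using f_weakly_convex by (simp add: weakly_convex_on_def)
  qed (use X feas diameter \<rho>h M_pos D_pos in auto)
  have \<Lambda>_eq: "\<Lambda> = multiplier"
    unfolding \<Lambda> multiplier_def by (simp add: G_def)
  \<comment> \<open>The tolerance level of both cases: both lower bounds on \<open>T\<close> depend
    on \<epsilon>, \<Lambda> and the moduli only through \<open>e\<^sup>2\<close>.\<close>
  define e where "e = \<epsilon>\<^sup>2 * (\<rho>h - \<rho>) / (1 + \<Lambda>)"
  have \<Lambda>_pos: "0 < \<Lambda>"
    using multiplier_pos by (simp add: \<Lambda>_eq)
  then have e_pos: "0 < e"
    using \<epsilon> \<rho>h by (simp add: e_def)
  have e_mult: "(1 + multiplier) * e = (\<rho>h - \<rho>) * \<epsilon>\<^sup>2"
    unfolding \<Lambda>_eq[symmetric] e_def using \<Lambda>_pos by simp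
  have e_sq: "e\<^sup>2 = \<epsilon>^4 * (\<rho>h - \<rho>)\<^sup>2 / (1 + \<Lambda>)\<^sup>2"
    by (simp add: e_def power_divide power_mult_distrib)
  have T_scale: "c * M\<^sup>2 * D\<^sup>2 * (1 + \<Lambda>)\<^sup>2 / (k * \<epsilon>^4 * (\<rho>h - \<rho>)\<^sup>2) = c * M\<^sup>2 * D\<^sup>2 / (k * e\<^sup>2)" for c k
    by (simp add: e_sq)
  obtain \<eta>_pos: "\<And>t. 0 < \<eta> t" and tol_nonneg: "\<And>t. 0 \<le> tol t"
    and ST: "S \<le> T" and tol_le: "\<And>t. S \<le> t \<Longrightarrow> t < T \<Longrightarrow> tol t \<le> e"
    and budget: "D\<^sup>2 / 2 + M\<^sup>2 / 2 * (\<Sum>t\<in>{S..<T}. (\<eta> t)\<^sup>2) < (\<Sum>t\<in>{S..<T}. \<eta> t * tol t)"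
    using cases
  proof (elim disjE conjE)
    assume S: "S = 0" and tol: "\<forall>t. tol t = \<epsilon>\<^sup>2 * (\<rho>h - \<rho>) / (1 + \<Lambda>)"
      and \<eta>: "\<forall>t. \<eta> t = 2 * \<epsilon>\<^sup>2 * (\<rho>h - \<rho>) / (5 * (1 + \<Lambda>) * M\<^sup>2)"
      and T_ge: "25 * M\<^sup>2 * D\<^sup>2 * (1 + \<Lambda>)\<^sup>2 / (4 * \<epsilon>^4 * (\<rho>h - \<rho>)\<^sup>2) \<le> real T"
    have tol': "tol t = e" for t
      using tol by (simp add: e_def)
    have \<eta>': "\<eta> t = 2 * e / (5 * M\<^sup>2)" for t
      unfolding \<eta>[rule_format] e_def
      by (simp only: times_divide_eq_right divide_divide_eq_left mult_ac)
    show thesis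
    proof (rule that)
      show "D\<^sup>2 / 2 + M\<^sup>2 / 2 * (\<Sum>t\<in>{S..<T}. (\<eta> t)\<^sup>2) < (\<Sum>t\<in>{S..<T}. \<eta> t * tol t)"
        unfolding S using M_pos e_pos T T_ge[unfolded T_scale] \<eta>' tol' by (rule constant_step_budget)
    qed (use e_pos M_pos in \<open>auto simp: S tol' \<eta>'\<close>)
  next
    assume S: "S = T div 2" and tol: "\<forall>t. tol t = 5 * M * D / sqrt (real t + 1)"
      and \<eta>: "\<forall>t. \<eta> t = D / (M * sqrt (real t + 1))"
      and T_ge: "50 * M\<^sup>2 * D\<^sup>2 * (1 + \<Lambda>)\<^sup>2 / (\<epsilon>^4 * (\<rho>h - \<rho>)\<^sup>2) \<le> real T"
    have T_ge': "50 * M\<^sup>2 * D\<^sup>2 / e\<^sup>2 \<le> real T"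
      using T_ge T_scale[of 50 1] by simp
    show thesis
    proof (rule that)
      show "tol t \<le> e" if "S \<le> t" for t
        using decreasing_tol_le[OF M_pos D_pos e_pos T_ge'] that by (simp add: tol S)
      show "D\<^sup>2 / 2 + M\<^sup>2 / 2 * (\<Sum>t\<in>{S..<T}. (\<eta> t)\<^sup>2) < (\<Sum>t\<in>{S..<T}. \<eta> t * tol t)"
        unfolding S using M_pos D_pos T by (rule decreasing_step_budget) (simp_all add: \<eta> tol)
    qed (use M_pos D_pos in \<open>auto simp: S tol \<eta>\<close>)
  qed
  \<comment> \<open>The subgradients of both kinds of step are collected into one sequence, so that
    the telescoping bound sees a single projected recursion.\<close>
  have "\<forall>t\<in>{..<T}. \<exists>\<zeta>. \<zeta> \<in> (if g (x t) \<le> ereal (tol t) then subdiff f (x t) else subdiff g (x t))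
      \<and> x (Suc t) = closest_point X (x t - \<eta> t *\<^sub>R \<zeta>)"
    using run unfolding switching_subgradient_run_def Bex_def by simp
  from bchoice[OF this] obtain \<zeta> where \<zeta>: "\<And>t. t < T \<Longrightarrow>
      \<zeta> t \<in> (if g (x t) \<le> ereal (tol t) then subdiff f (x t) else subdiff g (x t))"
    and step: "\<And>t. t < T \<Longrightarrow> x (Suc t) = closest_point X (x t - \<eta> t *\<^sub>R \<zeta> t)"
    by blast
  have xX: "x t \<in> X" if "t \<le> T" for t
  proof (cases t)
    case 0
    then show ?thesis
      using run by (simp add: switching_subgradient_run_def)
  next
    case (Suc s)
    then show ?thesis
      using step[of s] that feas closest_point_in_set[OF X(1)] by auto
  qed
  define p where "p t = prox_point \<rho>h X f g (x t)" for t
  have p: "is_prox (x t) (p t)" for t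
    unfolding p_def by (rule is_prox_prox_point[OF slater_prox_axioms f g contF contG])
  have I_eq: "I = {t\<in>{S..<T}. G (x t) \<le> tol t}"
    using g xX by (auto simp: I index_set_I_def)
  have less: "(\<Sum>t\<in>I. \<eta> t * ((\<rho>h - \<rho>) * (norm (p t - x t))\<^sup>2)) < (\<Sum>t\<in>I. \<eta> t * ((1 + multiplier) * e))"
  proof (rule sum_prox_distance_less[where \<zeta> = \<zeta>, OF ST xX p _ step])
    fix t assume t: "t < T"
    then have xt: "x t \<in> X" by (simp add: xX)
    show "norm (\<zeta> t) \<le> M"
      using \<zeta>[OF t] subdiff_bound xt by (auto split: if_splits)
    fix y assume y: "y \<in> X"
    show "F (x t) + \<zeta> t \<bullet> (y - x t) - \<rho> / 2 * (norm (y - x t))\<^sup>2 \<le> F y" if "G (x t) \<le> tol t"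
      using \<zeta>[OF t] that xt y by (intro F_lower) (simp_all add: g)
    show "G (x t) + \<zeta> t \<bullet> (y - x t) \<le> G y" if "\<not> G (x t) \<le> tol t"
      using \<zeta>[OF t] that xt y by (intro G_lower) (simp_all add: g)
  qed (use tol_nonneg \<eta>_pos tol_le budget I_eq in auto)
  \<comment> \<open>Over an empty \<open>I\<close> both sums vanish, contradicting the strict
    inequality.\<close>
  have I_ne: "I \<noteq> {}"
    using less by auto
  have I_fin: "finite I"
    by (simp add: I_eq)
  note E = expectation_output_index[OF I_fin I_ne \<eta>_pos]
  have W: "0 < (\<Sum>t\<in>I. \<eta> t)"
    using I_fin I_ne \<eta>_pos by (intro sum_pos) auto
  have pull: "(\<Sum>t\<in>I. \<eta> t * ((\<rho>h - \<rho>) * c t)) = (\<rho>h - \<rho>) * (\<Sum>t\<in>I. \<eta> t * c t)" for c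
    by (simp only: sum_distrib_left mult.left_commute)
  have "(\<rho>h - \<rho>) * (\<Sum>t\<in>I. \<eta> t * (norm (p t - x t))\<^sup>2) < (\<rho>h - \<rho>) * ((\<Sum>t\<in>I. \<eta> t) * \<epsilon>\<^sup>2)"
    using less unfolding e_mult pull sum_distrib_right[symmetric] by (simp only: mult.left_commute)
  then have sq: "(\<Sum>t\<in>I. \<eta> t * (norm (p t - x t))\<^sup>2) < (\<Sum>t\<in>I. \<eta> t) * \<epsilon>\<^sup>2"
    by (rule mult_left_less_imp_less) (use \<rho>h in simp)
  \<comment> \<open>The passage from mean square to mean uses
    \<open>2 * a * \<epsilon> \<le> a\<^sup>2 + \<epsilon>\<^sup>2\<close> in each term, in place of
    Jensen's inequality.\<close>
  have "2 * \<epsilon> * (\<Sum>t\<in>I. \<eta> t * norm (p t - x t)) = (\<Sum>t\<in>I. \<eta> t * (2 * norm (p t - x t) * \<epsilon>))"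
    unfolding sum_distrib_left by (intro sum.cong) simp_all
  also have "\<dots> \<le> (\<Sum>t\<in>I. \<eta> t * ((norm (p t - x t))\<^sup>2 + \<epsilon>\<^sup>2))"
    by (intro sum_mono mult_left_mono sum_squares_bound less_imp_le[OF \<eta>_pos])
  also have "\<dots> = (\<Sum>t\<in>I. \<eta> t * (norm (p t - x t))\<^sup>2) + (\<Sum>t\<in>I. \<eta> t) * \<epsilon>\<^sup>2"
    by (simp only: distrib_left sum.distrib sum_distrib_right)
  also have "\<dots> \<le> (\<Sum>t\<in>I. \<eta> t) * \<epsilon>\<^sup>2 + (\<Sum>t\<in>I. \<eta> t) * \<epsilon>\<^sup>2"
    using sq by simp
  also have "\<dots> = 2 * \<epsilon> * (\<epsilon> * (\<Sum>t\<in>I. \<eta> t))"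
    by (simp add: power2_eq_square)
  finally have "(\<Sum>t\<in>I. \<eta> t * norm (p t - x t)) \<le> \<epsilon> * (\<Sum>t\<in>I. \<eta> t)"
    by (rule mult_left_le_imp_le) (use \<epsilon> in simp)
  then have dist: "measure_pmf.expectation (output_index I \<eta>) (\<lambda>\<tau>. norm (p \<tau> - x \<tau>)) \<le> \<epsilon>"
    unfolding E using W by (simp add: pos_divide_le_eq)
  have "\<eta> t * G (x t) \<le> \<eta> t * e" if "t \<in> I" for t
    using that tol_le[of t] \<eta>_pos[of t] by (intro mult_left_mono) (auto simp: I_eq)
  then have "(\<Sum>t\<in>I. \<eta> t * G (x t)) \<le> (\<Sum>t\<in>I. \<eta> t) * e"
    unfolding sum_distrib_right by (rule sum_mono)
  then have "measure_pmf.expectation (output_index I \<eta>) (\<lambda>\<tau>. G (x \<tau>)) \<le> e"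
    unfolding E using W by (simp add: pos_divide_le_eq mult.commute)
  with dist I_ne show ?thesis
    unfolding p_def G_def e_def by blast
qed

end
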